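(* Let $G$ be a connected (fork, dart)-free graph. If $G$ contains an induced claw with center $v$, then $G[M(v)]$ is perfect.
   Context: All graphs are finite and simple. For a vertex $v$, $N(v)$ is its neighbourhood and $M(v)=V(G)\setminus(N(v)\cup\{v\})$. The claw is $K_{1,3}$; a vertex $v$ is a center of a claw if $v$ has three pairwise nonadjacent neighbours. The fork is obtained from $K_{1,3}$ by subdividing one edge once. The dart is the graph on $v_1,\dots,v_5$ where $\{v_1,v_2,v_3,v_4\}$ induces a claw with center $v_1$ and $v_5$ is adjacent to $v_1,v_3,v_4$ but not to $v_2$. $G$ is $(H_1,H_2)$-free if it has no induced subgraph isomorphic to $H_1$ or $H_2$. A graph is perfect if every induced subgraph $H$ satisfies $\chi(H)=\omega(H)$. *)

theory Defs
  imports Main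
begin

definition simple_graph :: "'a set \<Rightarrow> ('a \<Rightarrow> 'a \<Rightarrow> bool) \<Rightarrow> bool" where
  "simple_graph V E \<longleftrightarrow> finite V \<and> (\<forall>x y. E x y \<longrightarrow> x \<in> V \<and> y \<in> V)
     \<and> (\<forall>x y. E x y \<longrightarrow> E y x) \<and> (\<forall>x. \<not> E x x)"

definition connected_graph :: "'a set \<Rightarrow> ('a \<Rightarrow> 'a \<Rightarrow> bool) \<Rightarrow> bool" where
  "connected_graph V E \<longleftrightarrow> V \<noteq> {} \<and> (\<forall>x\<in>V. \<forall>y\<in>V. (\<lambda>a b. E a b \<and> a \<in> V \<and> b \<in> V)\<^sup>*\<^sup>* x y)"

definition nbhd :: "'a set \<Rightarrow> ('a \<Rightarrow> 'a \<Rightarrow> bool) \<Rightarrow> 'a \<Rightarrow> 'a set" where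
  "nbhd V E v = {u \<in> V. E v u}"

definition nonnbhd :: "'a set \<Rightarrow> ('a \<Rightarrow> 'a \<Rightarrow> bool) \<Rightarrow> 'a \<Rightarrow> 'a set" where
  "nonnbhd V E v = V - (nbhd V E v \<union> {v})"

definition contains_induced :: "'a set \<Rightarrow> ('a \<Rightarrow> 'a \<Rightarrow> bool) \<Rightarrow> 'b set \<Rightarrow> ('b \<Rightarrow> 'b \<Rightarrow> bool) \<Rightarrow> bool" where
  "contains_induced V E VH EH \<longleftrightarrow>
     (\<exists>f. inj_on f VH \<and> f ` VH \<subseteq> V \<and> (\<forall>x\<in>VH. \<forall>y\<in>VH. E (f x) (f y) \<longleftrightarrow> EH x y))"

definition fork_edges :: "nat \<Rightarrow> nat \<Rightarrow> bool" where
  "fork_edges x y \<longleftrightarrow> {x, y} \<in> {{0,1}, {0,2}, {0,3}, {3,4}}"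

definition fork_verts :: "nat set" where "fork_verts = {0,1,2,3,4}"

definition dart_edges :: "nat \<Rightarrow> nat \<Rightarrow> bool" where
  "dart_edges x y \<longleftrightarrow> {x, y} \<in> {{1,2}, {1,3}, {1,4}, {5,1}, {5,3}, {5,4}}"

definition dart_verts :: "nat set" where "dart_verts = {1,2,3,4,5}"

definition claw_center :: "'a set \<Rightarrow> ('a \<Rightarrow> 'a \<Rightarrow> bool) \<Rightarrow> 'a \<Rightarrow> bool" where
  "claw_center V E v \<longleftrightarrow> v \<in> V \<and> (\<exists>a b c. a \<in> nbhd V E v \<and> b \<in> nbhd V E v \<and> c \<in> nbhd V E v
      \<and> a \<noteq> b \<and> a \<noteq> c \<and> b \<noteq> c \<and> \<not> E a b \<and> \<not> E a c \<and> \<not> E b c)"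

definition proper_colouring :: "('a \<Rightarrow> 'a \<Rightarrow> bool) \<Rightarrow> 'a set \<Rightarrow> nat \<Rightarrow> ('a \<Rightarrow> nat) \<Rightarrow> bool" where
  "proper_colouring E S k c \<longleftrightarrow> (\<forall>x\<in>S. c x < k) \<and> (\<forall>x\<in>S. \<forall>y\<in>S. E x y \<longrightarrow> c x \<noteq> c y)"

definition chromatic_number :: "('a \<Rightarrow> 'a \<Rightarrow> bool) \<Rightarrow> 'a set \<Rightarrow> nat" where
  "chromatic_number E S = (LEAST k. \<exists>c. proper_colouring E S k c)"

definition is_clique :: "('a \<Rightarrow> 'a \<Rightarrow> bool) \<Rightarrow> 'a set \<Rightarrow> bool" where
  "is_clique E K \<longleftrightarrow> (\<forall>x\<in>K. \<forall>y\<in>K. x \<noteq> y \<longrightarrow> E x y)"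

definition clique_number :: "('a \<Rightarrow> 'a \<Rightarrow> bool) \<Rightarrow> 'a set \<Rightarrow> nat" where
  "clique_number E S = Max (card ` {K. K \<subseteq> S \<and> is_clique E K})"

definition perfect_on :: "('a \<Rightarrow> 'a \<Rightarrow> bool) \<Rightarrow> 'a set \<Rightarrow> bool" where
  "perfect_on E S \<longleftrightarrow> (\<forall>T. T \<subseteq> S \<longrightarrow> chromatic_number E T = clique_number E T)"

end

theory Submission
  imports Defs
begin

text \<open>
  Every nonempty \<open>T \<subseteq> M(v)\<close> has a vertex \<open>u\<close> such that each proper colouring of \<open>T - u\<close> with at least
  \<open>\<omega>(T)\<close> colours leaves a colour free for \<open>u\<close>; perfection follows by deleting vertices one by one.
  Fix a claw \<open>v; a, b, c\<close>.

  Suppose some \<open>x \<in> N(v)\<close> has two nonadjacent neighbours in \<open>T\<close>. As \<open>G\<close> is dart-free,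
  \<open>N(x) \<inter> T\<close> is a disjoint union of at least two cliques, and as \<open>G\<close> is fork-free, every other
  vertex of \<open>T\<close> is complete or anticomplete to it. So a vertex in a smaller one of two of these cliques
  can reuse a colour of the larger one.

  Otherwise \<open>N(a) \<inter> T\<close>, \<open>N(b) \<inter> T\<close>, \<open>N(c) \<inter> T\<close> are cliques. Fork-freeness gives each vertex
  of \<open>M(v)\<close> either no or at least two neighbours in \<open>{a, b, c}\<close>, so the union of these three cliques
  is a clique. The remaining vertices of \<open>M(v)\<close> are exactly those at distance 3 from \<open>v\<close>; they
  induce a disjoint union of cliques, each complete or anticomplete to every vertex at distance 2.
  So each remaining vertex of \<open>T\<close> is simplicial in \<open>T\<close>.
\<close>

section \<open>Colourings and cliques\<close>

lemma clique_number_ge: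
  assumes "finite T" "K \<subseteq> T" "is_clique E K"
  shows "card K \<le> clique_number E T"
  unfolding clique_number_def using assms by (intro Max_ge) auto

lemma clique_number_attained:
  assumes "finite T"
  obtains K where "K \<subseteq> T" "is_clique E K" "card K = clique_number E T"
proof -
  have "clique_number E T \<in> card ` {K. K \<subseteq> T \<and> is_clique E K}"
    unfolding clique_number_def
  proof (rule Max_in)
    show "finite (card ` {K. K \<subseteq> T \<and> is_clique E K})" using assms by auto
    have "is_clique E {}" by (simp add: is_clique_def)
    then show "card ` {K. K \<subseteq> T \<and> is_clique E K} \<noteq> {}" by blast
  qed
  then show thesis using that by auto
qed

lemma clique_number_mono:
  assumes "finite T" "U \<subseteq> T"
  shows "clique_number E U \<le> clique_number E T"
proof -
  obtain K where "K \<subseteq> U" "is_clique E K" "card K = clique_number E U"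
    using clique_number_attained finite_subset[OF assms(2,1)] by metis
  then show ?thesis using clique_number_ge[of T K E] assms by auto
qed

lemma clique_number_le_colours:
  assumes "finite T" "proper_colouring E T k c"
  shows "clique_number E T \<le> k"
proof -
  obtain K where K: "K \<subseteq> T" "is_clique E K" "card K = clique_number E T"
    using clique_number_attained[OF assms(1)] by metis
  have "inj_on c K"
    using K(1,2) assms(2) unfolding inj_on_def is_clique_def proper_colouring_def by (meson subsetD)
  moreover have "c ` K \<subseteq> {..<k}" using K(1) assms(2) by (auto simp: proper_colouring_def)
  ultimately have "card K \<le> card {..<k}" using card_inj_on_le by blast
  then show ?thesis using K(3) by simp
qed

text \<open>Induction deletes \<open>u\<close> and colours the rest. Deletion may lower the clique
  number, so \<open>col\<close> allows \<open>d\<close> spare colours and \<open>free\<close> has to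
  serve every \<open>k\<close> from \<open>clique_number E T\<close> up.\<close>

lemma perfect_onI_free_colour:
  assumes fin: "finite S" and sym: "symp E" and irr: "irreflp E"
    and free: "\<And>T. T \<subseteq> S \<Longrightarrow> T \<noteq> {} \<Longrightarrow>
      \<exists>u\<in>T. \<forall>k c. proper_colouring E (T - {u}) k c \<and> clique_number E T \<le> k \<longrightarrow>
        (\<exists>i<k. \<forall>w\<in>T. E u w \<longrightarrow> c w \<noteq> i)"
  shows "perfect_on E S"
proof -
  have col: "\<exists>c. proper_colouring E T (clique_number E T + d) c" if "T \<subseteq> S" for T d
    using finite_subset[OF that fin] that
  proof (induction T arbitrary: d rule: finite_psubset_induct)
    case (psubset T)
    show ?case
    proof (cases "T = {}")
      case True
      then show ?thesis by (simp add: proper_colouring_def)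
    next
      case False
      let ?k = "clique_number E T + d"
      obtain u where u: "u \<in> T" and ext: "\<And>k c. proper_colouring E (T - {u}) k c \<Longrightarrow>
          clique_number E T \<le> k \<Longrightarrow> \<exists>i<k. \<forall>w\<in>T. E u w \<longrightarrow> c w \<noteq> i"
        using free[OF psubset.prems False] by blast
      have "clique_number E (T - {u}) \<le> clique_number E T"
        using clique_number_mono psubset.hyps by blast
      then have "?k = clique_number E (T - {u}) + (?k - clique_number E (T - {u}))" by simp
      moreover have "T - {u} \<subset> T" "T - {u} \<subseteq> S" using u psubset.prems by auto
      ultimately obtain c where c: "proper_colouring E (T - {u}) ?k c"
        using psubset.IH by metis
      then obtain i where i: "i < ?k" "\<forall>w\<in>T. E u w \<longrightarrow> c w \<noteq> i"
        using ext[of ?k c] by auto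
      have "proper_colouring E T ?k (c(u := i))"
        using c i sympD[OF sym] irreflpD[OF irr] unfolding proper_colouring_def by auto
      then show ?thesis by blast
    qed
  qed
  show ?thesis unfolding perfect_on_def
  proof (intro allI impI)
    fix T assume T: "T \<subseteq> S"
    show "chromatic_number E T = clique_number E T"
      unfolding chromatic_number_def
    proof (rule Least_equality)
      show "\<exists>c. proper_colouring E T (clique_number E T) c" using col[OF T, of 0] by simp
    qed (use clique_number_le_colours finite_subset[OF T fin] in blast)
  qed
qed

text \<open>The clique formed by \<open>u\<close> and its neighbours in \<open>T\<close> has at most
  \<open>k\<close> vertices, so fewer than \<open>k\<close> colours occur on the neighbours.\<close>

lemma free_colour_simplicial:
  assumes fin: "finite T" and irr: "irreflp E" and u: "u \<in> T"
    and simpl: "is_clique E (insert u {w \<in> T. E u w})"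
    and k: "clique_number E T \<le> k"
  shows "\<exists>i<k. \<forall>w\<in>T. E u w \<longrightarrow> c w \<noteq> i"
proof -
  let ?N = "{w \<in> T. E u w}"
  have "u \<notin> ?N" using irr by (simp add: irreflpD)
  then have "card ?N < card (insert u ?N)" using fin by simp
  also have "\<dots> \<le> k" using clique_number_ge[OF fin _ simpl] u k by auto
  finally have "card (c ` ?N) < card {..<k}" using card_image_le[of ?N c] fin by simp
  then have "\<not> {..<k} \<subseteq> c ` ?N" using card_mono[of "c ` ?N" "{..<k}"] fin by auto
  then obtain i where "i < k" "i \<notin> c ` ?N" by blast
  then show ?thesis by auto
qed

text \<open>\<open>Q\<close> shows \<open>card Q\<close> distinct colours and \<open>P - {u}\<close>
  fewer, so some \<open>q\<close> in \<open>Q\<close> has a colour absent from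
  \<open>P - {u}\<close>. Neighbours of \<open>u\<close> outside \<open>P\<close> are adjacent to
  \<open>q\<close>, hence avoid that colour too.\<close>

lemma free_colour_from_larger_clique:
  assumes fin: "finite T" and irr: "irreflp E"
    and Q: "Q \<subseteq> T" "is_clique E Q" and P: "P \<subseteq> T" "u \<in> P" "card P \<le> card Q" "u \<notin> Q"
    and nb: "\<And>w q. w \<in> T \<Longrightarrow> E u w \<Longrightarrow> w \<notin> P \<Longrightarrow> q \<in> Q \<Longrightarrow> E q w"
    and c: "proper_colouring E (T - {u}) k c"
  shows "\<exists>i<k. \<forall>w\<in>T. E u w \<longrightarrow> c w \<noteq> i"
proof -
  have finP: "finite P" and finQ: "finite Q" using P(1) Q(1) fin finite_subset by auto
  have sub: "Q \<subseteq> T - {u}" using Q(1) P(4) by auto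
  have "inj_on c Q"
    using sub Q(2) c unfolding inj_on_def is_clique_def proper_colouring_def by (meson subsetD)
  then have "card (c ` Q) = card Q" by (rule card_image)
  moreover have "card (c ` (P - {u})) \<le> card (P - {u})" using finP by (simp add: card_image_le)
  moreover have "card (P - {u}) < card P" using finP P(2) by (rule card_Diff1_less)
  ultimately have "card (c ` (P - {u})) < card (c ` Q)" using P(3) by linarith
  then have "\<not> c ` Q \<subseteq> c ` (P - {u})"
    using card_mono[of "c ` (P - {u})" "c ` Q"] finP by auto
  then obtain q where q: "q \<in> Q" "c q \<notin> c ` (P - {u})" by blast
  have "c q < k" using c q(1) sub by (auto simp: proper_colouring_def)
  moreover have "c w \<noteq> c q" if w: "w \<in> T" "E u w" for w
  proof (cases "w \<in> P")
    case True
    then show ?thesis using q(2) w irr by (metis DiffI image_eqI irreflpD singletonD)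
  next
    case False
    moreover have "w \<noteq> u" using w irr by (auto dest: irreflpD)
    ultimately show ?thesis using nb[OF w False q(1)] c q(1) sub w(1)
      unfolding proper_colouring_def by (metis DiffI singletonD subsetD)
  qed
  ultimately show ?thesis by blast
qed

section \<open>Claws in fork- and dart-free graphs\<close>

locale fork_dart_free =
  fixes V :: "'a set" and E :: "'a \<Rightarrow> 'a \<Rightarrow> bool"
  assumes graph: "simple_graph V E"
    and fork_free: "\<not> contains_induced V E fork_verts fork_edges"
    and dart_free: "\<not> contains_induced V E dart_verts dart_edges"
begin

lemma finite_V: "finite V"
  and E_in_V: "E x y \<Longrightarrow> x \<in> V \<and> y \<in> V"
  and E_sym: "E x y \<Longrightarrow> E y x"
  and E_irrefl: "\<not> E x x"
  using graph by (auto simp: simple_graph_def)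

text \<open>\<open>p\<close> is the centre and \<open>s\<close>, \<open>t\<close> the long branch.
  The adjacencies separate all pairs except \<open>q\<close> and \<open>r\<close>.\<close>

lemma no_fork:
  assumes "E p q" "E p r" "E p s" "E s t" "q \<noteq> r"
    and "\<not> E q r" "\<not> E q s" "\<not> E r s" "\<not> E p t" "\<not> E q t" "\<not> E r t"
  shows False
proof -
  let ?f = "\<lambda>n::nat. if n = 0 then p else if n = 1 then q else if n = 2 then r
    else if n = 3 then s else t"
  have ne: "p \<noteq> q" "p \<noteq> r" "p \<noteq> s" "p \<noteq> t" "q \<noteq> s" "q \<noteq> t" "r \<noteq> s" "r \<noteq> t" "s \<noteq> t"
    using assms E_irrefl E_sym by metis+
  have sym: "E q p" "E r p" "E s p" "E t s" "\<not> E r q" "\<not> E s q" "\<not> E s r" "\<not> E t p" "\<not> E t q" "\<not> E t r"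
    using assms E_sym by blast+
  have "contains_induced V E fork_verts fork_edges"
    unfolding contains_induced_def
  proof (rule exI[of _ ?f], intro conjI)
    show "inj_on ?f fork_verts"
      using ne assms(5) by (auto simp: inj_on_def fork_verts_def)
    show "?f ` fork_verts \<subseteq> V" using assms(1-4) E_in_V by (auto simp: fork_verts_def)
    show "\<forall>x\<in>fork_verts. \<forall>y\<in>fork_verts. E (?f x) (?f y) = fork_edges x y"
      using assms sym E_irrefl by (simp add: fork_verts_def fork_edges_def doubleton_eq_iff)
  qed
  then show False using fork_free by blast
qed

text \<open>\<open>p\<close>, \<open>q\<close>, \<open>r\<close>, \<open>s\<close>, \<open>t\<close>
  are the vertices 1 to 5 of \<open>dart_edges\<close>, so \<open>q\<close> is the pendant
  one.\<close>

lemma no_dart: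
  assumes "E p q" "E p r" "E p s" "E p t" "E t r" "E t s" "r \<noteq> s"
    and "\<not> E q r" "\<not> E q s" "\<not> E r s" "\<not> E q t"
  shows False
proof -
  let ?f = "\<lambda>n::nat. if n = 1 then p else if n = 2 then q else if n = 3 then r
    else if n = 4 then s else t"
  have ne: "p \<noteq> q" "p \<noteq> r" "p \<noteq> s" "p \<noteq> t" "q \<noteq> r" "q \<noteq> s" "q \<noteq> t" "r \<noteq> t" "s \<noteq> t"
    using assms E_irrefl E_sym by metis+
  have sym: "E q p" "E r p" "E s p" "E t p" "E r t" "E s t"
    "\<not> E r q" "\<not> E s q" "\<not> E s r" "\<not> E t q"
    using assms E_sym by blast+
  have "contains_induced V E dart_verts dart_edges"
    unfolding contains_induced_def
  proof (rule exI[of _ ?f], intro conjI)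
    show "inj_on ?f dart_verts"
      using ne assms(7) by (auto simp: inj_on_def dart_verts_def)
    show "?f ` dart_verts \<subseteq> V" using assms(1-6) E_in_V by (auto simp: dart_verts_def)
    show "\<forall>x\<in>dart_verts. \<forall>y\<in>dart_verts. E (?f x) (?f y) = dart_edges x y"
      using assms sym E_irrefl by (simp add: dart_verts_def dart_edges_def doubleton_eq_iff)
  qed
  then show False using dart_free by blast
qed

lemma free_colour_if_nbhd_not_clique:
  assumes T: "T \<subseteq> nonnbhd V E v" and x: "E v x"
    and uu: "p \<in> T" "q \<in> T" "E x p" "E x q" "p \<noteq> q" "\<not> E p q"
  shows "\<exists>u\<in>T. \<forall>k c. proper_colouring E (T - {u}) k c \<longrightarrow>
    (\<exists>i<k. \<forall>w\<in>T. E u w \<longrightarrow> c w \<noteq> i)"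
proof -
  have fin: "finite T" using T finite_V finite_subset unfolding nonnbhd_def by blast
  have nv: "\<not> E v t" "v \<noteq> t" if "t \<in> T" for t using T that by (auto simp: nonnbhd_def nbhd_def)
  \<comment> \<open>An induced path \<open>r\<close>, \<open>s\<close>, \<open>t\<close> would make
    a dart with centre \<open>x\<close> and pendant vertex \<open>v\<close>.\<close>
  have P3: "E r t" if "r \<in> T" "s \<in> T" "t \<in> T" "E x r" "E x s" "E x t" "E r s" "E s t" "r \<noteq> t"
    for r s t
    using no_dart[of x v r t s] that x nv E_sym by blast
  \<comment> \<open>Otherwise \<open>x\<close> with leaves \<open>v\<close>, \<open>s\<close> and
    long branch \<open>r\<close>, \<open>z\<close> is a fork.\<close>
  have adj: "E z s"
    if "z \<in> T" "\<not> E x z" "r \<in> T" "s \<in> T" "E x r" "E x s" "r \<noteq> s" "\<not> E r s" "E z r" for z r s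
    using no_fork[of x v s r z] that x nv E_sym by blast
  have main: "\<exists>u\<in>T. \<forall>k c. proper_colouring E (T - {u}) k c \<longrightarrow>
      (\<exists>i<k. \<forall>w\<in>T. E u w \<longrightarrow> c w \<noteq> i)"
    if p: "p \<in> T" "E x p" and q: "q \<in> T" "E x q" and pq: "p \<noteq> q" "\<not> E p q"
      and le: "card (insert p {w \<in> T. E x w \<and> E p w}) \<le> card (insert q {w \<in> T. E x w \<and> E q w})"
    for p q
  proof (intro bexI[of _ p] allI impI)
    let ?P = "insert p {w \<in> T. E x w \<and> E p w}" and ?Q = "insert q {w \<in> T. E x w \<and> E q w}"
    fix k c assume c: "proper_colouring E (T - {p}) k c"
    have irr: "irreflp E" using E_irrefl by (simp add: irreflpI)
    have cl: "is_clique E ?Q"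
      unfolding is_clique_def using P3 q E_sym by blast
    \<comment> \<open>Here \<open>w\<close> is not adjacent to \<open>x\<close>, and
      \<open>p\<close>, \<open>s\<close> lie in different cliques, so \<open>adj\<close> carries
      adjacency to \<open>w\<close> from \<open>p\<close> over to \<open>s\<close>.\<close>
    have nb: "E s w" if w: "w \<in> T" "E p w" "w \<notin> ?P" and s: "s \<in> ?Q" for w s
    proof -
      have "\<not> E p s" using s pq P3[of p s q] p q E_sym by blast
      moreover have "p \<noteq> s" using s pq E_sym by blast
      moreover have "\<not> E x w" "s \<in> T" "E x s" using w s q by auto
      ultimately show ?thesis using adj[of w p s] w p E_sym by blast
    qed
    show "\<exists>i<k. \<forall>w\<in>T. E p w \<longrightarrow> c w \<noteq> i"
    proof (rule free_colour_from_larger_clique[OF fin irr _ cl _ _ le _ nb c])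
      show "p \<notin> ?Q" using pq E_sym by blast
    qed (use p q in auto)
  qed (rule p(1))
  show ?thesis
  proof (cases "card (insert p {w \<in> T. E x w \<and> E p w}) \<le> card (insert q {w \<in> T. E x w \<and> E q w})")
    case True
    with uu show ?thesis by (intro main[of p q])
  next
    case False
    moreover have "\<not> E q p" using uu E_sym by blast
    ultimately show ?thesis using uu by (intro main[of q p]) auto
  qed
qed

end

section \<open>Distance layers around a claw centre\<close>

locale claw_in_fork_dart_free = fork_dart_free +
  fixes v a b c :: 'a
  assumes claw: "E v a" "E v b" "E v c" "a \<noteq> b" "a \<noteq> c" "b \<noteq> c" "\<not> E a b" "\<not> E a c" "\<not> E b c"
    and conn: "connected_graph V E"
begin

abbreviation M :: "'a set" where "M \<equiv> nonnbhd V E v"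

definition near :: "'a \<Rightarrow> bool" where
  "near y \<longleftrightarrow> E a y \<or> E b y \<or> E c y"

lemma M_iff: "y \<in> M \<longleftrightarrow> y \<in> V \<and> \<not> E v y \<and> y \<noteq> v"
  by (auto simp: nonnbhd_def nbhd_def)

text \<open>If \<open>y\<close> saw just one of \<open>a\<close>, \<open>b\<close>,
  \<open>c\<close>, that edge would extend the claw at \<open>v\<close> to a fork.\<close>

lemma near_two:
  assumes "y \<in> M" "near y"
  shows "E a y \<and> E b y \<or> E a y \<and> E c y \<or> E b y \<and> E c y"
  using assms claw no_fork[of v b c a y] no_fork[of v a c b y] no_fork[of v a b c y] E_sym
  unfolding near_def M_iff by blast

text \<open>Two of \<open>a\<close>, \<open>b\<close>, \<open>c\<close> agree on being adjacent to
  \<open>x\<close>. If \<open>y\<close> misses all three, adjacency gives a dart centred at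
  \<open>x\<close>, nonadjacency a fork centred at \<open>v\<close>. So within \<open>M\<close>,
  \<open>near\<close> singles out distance 2 from \<open>v\<close>.\<close>

lemma near_if_adjacent_nbhd:
  assumes y: "y \<in> M" and x: "E v x" "E x y"
  shows "near y"
proof (rule ccontr)
  assume far: "\<not> near y"
  have two: False
    if "E v p" "E v q" "p \<noteq> q" "\<not> E p q" "\<not> E p y" "\<not> E q y" "E x p \<longleftrightarrow> E x q" for p q
  proof (cases "E x p")
    case True
    then show False using no_dart[of x y p q v] that x y E_sym unfolding M_iff by blast
  next
    case False
    then show False using no_fork[of v p q x y] that x y E_sym unfolding M_iff by blast
  qed
  show False using two[of a b] two[of a c] two[of b c] claw far unfolding near_def by blast
qed

text \<open>Otherwise two claw leaves adjacent to \<open>y\<close> are the short branches of a fork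
  centred at \<open>y\<close> with long branch \<open>z\<close>, \<open>w\<close>.\<close>

lemma far_edge_same_near:
  assumes "y \<in> M" "near y" "\<not> near z" "\<not> near w" "E y z" "E z w"
  shows "E y w"
proof (rule ccontr)
  assume "\<not> E y w"
  then have False if "E p y" "E q y" "p \<noteq> q" "\<not> E p q" "\<not> E p z" "\<not> E q z" "\<not> E p w" "\<not> E q w" for p q
    using no_fork[of y p q z w] that assms E_sym by blast
  then show False using near_two[OF assms(1,2)] assms(3,4) claw unfolding near_def by blast
qed

text \<open>Along a walk from \<open>v\<close>, the predecessor \<open>t\<close> of a far vertex of
  \<open>M\<close> lies in \<open>M\<close>. Either \<open>t\<close> is near, or its near neighbour
  is passed on by \<open>far_edge_same_near\<close>.\<close>

lemma far_has_near_nbr: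
  assumes "z \<in> M" "\<not> near z"
  shows "\<exists>y\<in>M. near y \<and> E y z"
proof -
  have "v \<in> V" using claw E_in_V by blast
  moreover have "z \<in> V" using assms M_iff by blast
  ultimately have "(\<lambda>a b. E a b \<and> a \<in> V \<and> b \<in> V)\<^sup>*\<^sup>* v z"
    using conn unfolding connected_graph_def by blast
  then have "z \<in> M \<longrightarrow> \<not> near z \<longrightarrow> (\<exists>y\<in>M. near y \<and> E y z)"
  proof induction
    case base
    then show ?case by (simp add: M_iff)
  next
    case (step t w)
    show ?case
    proof (intro impI)
      assume w: "w \<in> M" "\<not> near w"
      then have "t \<in> M" using near_if_adjacent_nbhd[OF w(1)] step.hyps(2) unfolding M_iff by blast
      then show "\<exists>y\<in>M. near y \<and> E y w"
        using step w far_edge_same_near by blast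
    qed
  qed
  then show ?thesis using assms by blast
qed

text \<open>A near neighbour \<open>y\<close> of \<open>z\<close> also sees \<open>w\<close> and
  \<open>t\<close>. Were these nonadjacent, \<open>y\<close> would centre a dart with a claw leaf as
  pendant vertex.\<close>

lemma far_nbrs_adjacent:
  assumes "z \<in> M" "\<not> near z" "\<not> near w" "\<not> near t" "E z w" "E z t" "w \<noteq> t"
  shows "E w t"
proof (rule ccontr)
  assume wt: "\<not> E w t"
  obtain y where y: "y \<in> M" "near y" "E y z" using far_has_near_nbr[OF assms(1,2)] by blast
  have "E y w" "E y t" using far_edge_same_near y assms by blast+
  moreover obtain p where "E p y" "\<not> E p z" "\<not> E p w" "\<not> E p t"
    using y(2) assms(2-4) unfolding near_def by blast
  ultimately show False using no_dart[of y p w t z] wt y(3) assms E_sym by blast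
qed

lemma free_colour:
  assumes T: "T \<subseteq> M" "T \<noteq> {}"
  shows "\<exists>u\<in>T. \<forall>k c. proper_colouring E (T - {u}) k c \<and> clique_number E T \<le> k \<longrightarrow>
        (\<exists>i<k. \<forall>w\<in>T. E u w \<longrightarrow> c w \<noteq> i)"
proof (cases "\<forall>x p q. E v x \<and> p \<in> T \<and> q \<in> T \<and> E x p \<and> E x q \<and> p \<noteq> q \<longrightarrow> E p q")
  case False
  then obtain x p q where "E v x" "p \<in> T" "q \<in> T" "E x p" "E x q" "p \<noteq> q" "\<not> E p q"
    by blast
  from free_colour_if_nbhd_not_clique[OF T(1) this] show ?thesis by blast
next
  case True
  have fin: "finite T" using T finite_V finite_subset unfolding nonnbhd_def by blast
  have irr: "irreflp E" using E_irrefl by (simp add: irreflpI)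
  \<comment> \<open>Two subsets of size at least two of \<open>{a, b, c}\<close> meet.\<close>
  have near_clique: "E p q" if pq: "p \<in> T" "q \<in> T" "near p" "near q" "p \<noteq> q" for p q
  proof -
    obtain x where "E v x" "E x p" "E x q"
      using near_two[of p] near_two[of q] pq T(1) claw by blast
    then show ?thesis using True pq by blast
  qed
  \<comment> \<open>Take a far vertex if \<open>T\<close> has one; otherwise all of \<open>T\<close>
    is near, hence a clique.\<close>
  obtain u where u: "u \<in> T" "near u \<longrightarrow> (\<forall>w\<in>T. near w)" using T(2) by blast
  have "E w t" if wt: "w \<in> T" "t \<in> T" "E u w" "E u t" "w \<noteq> t" for w t
  proof (cases "near u")
    case True
    then show ?thesis using near_clique u wt by blast
  next
    case False
    have mixed: "E r s" if "r \<in> T" "near r" "\<not> near s" "E u r" "E u s" for r s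
      using far_edge_same_near[of r u s] that False T(1) E_sym by blast
    show ?thesis
      using near_clique[of w t] mixed[of w t] mixed[of t w] far_nbrs_adjacent[of u w t]
        wt u(1) T(1) False E_sym by blast
  qed
  then have "is_clique E (insert u {w \<in> T. E u w})"
    unfolding is_clique_def using E_sym by blast
  then show ?thesis using free_colour_simplicial[OF fin irr u(1)] u(1) by blast
qed

end

theorem theorem3p5:
  fixes V :: "'a set" and E :: "'a \<Rightarrow> 'a \<Rightarrow> bool" and v :: 'a
  assumes "simple_graph V E"
    and "connected_graph V E"
    and "\<not> contains_induced V E fork_verts fork_edges"
    and "\<not> contains_induced V E dart_verts dart_edges"
    and "claw_center V E v"
  shows "perfect_on E (nonnbhd V E v)"
proof -
  obtain a b c where "E v a" "E v b" "E v c" "a \<noteq> b" "a \<noteq> c" "b \<noteq> c"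
    "\<not> E a b" "\<not> E a c" "\<not> E b c"
    using assms(5) unfolding claw_center_def nbhd_def by blast
  then interpret claw_in_fork_dart_free V E v a b c
    using assms by unfold_locales auto
  show ?thesis
  proof (rule perfect_onI_free_colour)
    show "finite M" using finite_V by (simp add: nonnbhd_def)
    show "symp E" using E_sym by (rule sympI)
    show "irreflp E" using E_irrefl by (rule irreflpI)
  qed (rule free_colour)
qed

end
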